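(* Let $\kappa<\aleph_\omega$ be a cardinal and let $L$ be a $\kappa$-Suslin Line. Then $\pi Nt(L)=\kappa^+$.
   Context: All topological spaces have at least two points. A $\kappa$-Suslin Line is a linearly ordered set $L$ such that: (1) $L$ is dense, i.e. the order topology on $L$ has no isolated points; (2) $L$ is complete, i.e. every non-empty bounded subset of $L$ has an infimum and a supremum; (3) $L$ has cellularity no greater than $\kappa$, i.e. no pairwise disjoint family of non-empty open intervals of $L$ has size $\kappa^+$; (4) $L$ has density greater than $\kappa$, i.e. no set of size $\kappa$ is dense in $L$ with the order topology. $L$ is regarded as a space with the order topology. A $\pi$-base of a space $X$ is a set $\mathcal{P}$ of non-empty open subsets of $X$ such that every non-empty open subset of $X$ contains a member of $\mathcal{P}$. A family $\mathcal{P}$ of sets is $\kappa^{op}$-like (with respect to $\supseteq$) if every bounded subset of the poset $(\mathcal{P},\supseteq)$ has size strictly less than $\kappa$, i.e. for every $P\in\mathcal{P}$, the set $\{Q\in\mathcal{P}: P\subseteq Q\}$ has cardinality less than $\kappa$. The Noetherian $\pi$-type $\pi Nt(X)$ is the minimum cardinal $\kappa$ such that $X$ has a $\kappa^{op}$-like $\pi$-base. *)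

theory Defs
  imports "HOL-Analysis.Elementary_Topology" "HOL-Library.Lub_Glb"
begin

unbundle cardinal_syntax

(* Cardinals are relations r with Card_order r. They are compared up to =o, so every predicate
   below is invariant under =o. *)

(* The recursion can stay on one type: if r =o cardSuc s, then s <o r, so s has a copy on a
   subset of Field r. *)
primrec is_aleph :: "nat \<Rightarrow> 'c rel \<Rightarrow> bool" where
  "is_aleph 0 r \<longleftrightarrow> Card_order r \<and> r =o natLeq"
| "is_aleph (Suc n) r \<longleftrightarrow>
     Card_order r \<and> (\<exists>s :: 'c rel. is_aleph n s \<and> r =o cardSuc s)"

(* Aleph_omega is the supremum of the cardinals Aleph_n, so being below it means being below some
   Aleph_n. HOL need not provide a type of size Aleph_omega, hence no relation for it is used. The
   type (nat + 'c) set is large enough for a witness: it carries Aleph_0, and the successor of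
   every cardinal on 'c. *)
definition less_aleph_omega :: "'c rel \<Rightarrow> bool" where
  "less_aleph_omega \<kappa> \<longleftrightarrow>
     (\<exists>n. \<exists>\<alpha> :: (nat + 'c) set rel. is_aleph n \<alpha> \<and> \<kappa> <o \<alpha>)"

(* The linear order is the type 'a itself; class linorder_topology says that its topology is the
   order topology. Only the absence of isolated points is required, not order density: jumps are
   allowed. In the last clause, density greater than \<kappa> is expressed with \<le>o: with =o the
   clause would hold trivially for spaces of size less than \<kappa>. *)
definition Suslin_line :: "'c rel \<Rightarrow> 'a::linorder_topology itself \<Rightarrow> bool" where
  "Suslin_line \<kappa> (L :: 'a itself) \<longleftrightarrow>
     (\<exists>x y :: 'a. x \<noteq> y) \<and>
     (\<forall>x :: 'a. \<not> open {x}) \<and>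
     (\<forall>S :: 'a set. S \<noteq> {} \<and> bdd_below S \<and> bdd_above S \<longrightarrow>
        (\<exists>i. isGlb UNIV S i) \<and> (\<exists>s. isLub UNIV S s)) \<and>
     \<not> (\<exists>\<F> :: 'a set set. (\<forall>I\<in>\<F>. I \<noteq> {} \<and> (\<exists>a b. I = {a<..<b})) \<and>
          pairwise disjnt \<F> \<and> |\<F>| =o cardSuc \<kappa>) \<and>
     \<not> (\<exists>D :: 'a set. |D| \<le>o \<kappa> \<and> closure D = UNIV)"

definition pi_base :: "'a::topological_space set set \<Rightarrow> bool" where
  "pi_base \<P> \<longleftrightarrow>
     (\<forall>P\<in>\<P>. open P \<and> P \<noteq> {}) \<and>
     (\<forall>U. open U \<and> U \<noteq> {} \<longrightarrow> (\<exists>P\<in>\<P>. P \<subseteq> U))"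

definition op_like :: "'c rel \<Rightarrow> 'a set set \<Rightarrow> bool" where
  "op_like \<kappa> \<P> \<longleftrightarrow> (\<forall>P\<in>\<P>. |{Q \<in> \<P>. P \<subseteq> Q}| <o \<kappa>)"

definition is_piNt :: "'a::topological_space itself \<Rightarrow> 'c rel \<Rightarrow> bool" where
  "is_piNt (X :: 'a itself) \<mu> \<longleftrightarrow>
     Card_order \<mu> \<and> (\<exists>\<P> :: 'a set set. pi_base \<P> \<and> op_like \<mu> \<P>) \<and>
     (\<forall>\<nu> :: 'c rel. Card_order \<nu> \<and> (\<exists>\<P> :: 'a set set. pi_base \<P> \<and> op_like \<nu> \<P>)
        \<longrightarrow> \<mu> \<le>o \<nu>)"

(* The minimum is chosen among the cardinals on 'a set set, one of which is the successor of the
   cardinality of 'a set. By is_piNt_piNt and piNt_le it exists, and it is the minimum over the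
   cardinals on all types. *)
definition piNt :: "'a::topological_space itself \<Rightarrow> 'a set set rel" where
  "piNt X = (SOME \<mu>. is_piNt X \<mu>)"

lemma is_piNt_piNt: "is_piNt TYPE('a::topological_space) (piNt TYPE('a))"
proof -
  let ?R = "{\<mu> :: 'a set set rel. Card_order \<mu> \<and>
    (\<exists>\<P> :: 'a set set. pi_base \<P> \<and> op_like \<mu> \<P>)}"
  let ?s = "cardSuc |UNIV :: 'a set set|"
  have "|A| <o ?s" for A :: "'a set set"
    using card_of_mono1[OF subset_UNIV] cardSuc_greater[OF card_of_Card_order]
    by (rule ordLeq_ordLess_trans)
  then have "pi_base {U :: 'a set. open U \<and> U \<noteq> {}} \<and>
      op_like ?s {U :: 'a set. open U \<and> U \<noteq> {}}"
    unfolding pi_base_def op_like_def by blast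
  then have "?s \<in> ?R"
    using cardSuc_Card_order[OF card_of_Card_order] by blast
  then obtain \<mu> where "\<mu> \<in> ?R" "\<forall>\<nu>\<in>?R. \<mu> \<le>o \<nu>"
    using exists_minim_Card_order[of ?R] by blast
  then have "is_piNt TYPE('a) \<mu>"
    unfolding is_piNt_def by blast
  then show ?thesis
    unfolding piNt_def by (rule someI)
qed

lemma piNt_le:
  fixes \<nu> :: "'c rel" and \<P> :: "'a::topological_space set set"
  assumes "Card_order \<nu>" "pi_base \<P>" "op_like \<nu> \<P>"
  shows "piNt TYPE('a) \<le>o \<nu>"
proof (rule ccontr)
  let ?p = "piNt TYPE('a)"
  have p: "Card_order ?p"
    using is_piNt_piNt[where 'a='a] by (simp add: is_piNt_def)
  assume "\<not> ?p \<le>o \<nu>"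
  then have less: "\<nu> <o ?p"
    using p assms(1) by (simp add: not_ordLeq_iff_ordLess card_order_on_well_order_on)
  have "|Field \<nu>| \<le>o |Field ?p|"
    using less p assms(1)
    by (meson card_of_Field_ordIso ordIso_ordLeq_trans ordIso_symmetric ordLeq_ordIso_trans
        ordLess_imp_ordLeq)
  then obtain f where f: "inj_on f (Field \<nu>)" "f ` Field \<nu> \<subseteq> Field ?p"
    by (auto simp: card_of_ordLeq[symmetric])
  let ?n = "|f ` Field \<nu>|"
  have iso: "?n =o \<nu>"
    using f(1) assms(1)
    by (meson card_of_Field_ordIso card_of_ordIsoI inj_on_imp_bij_betw ordIso_symmetric
        ordIso_transitive)
  have "op_like ?n \<P>"
    using assms(3) iso unfolding op_like_def
    by (meson ordIso_symmetric ordLess_ordIso_trans)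
  then have "?p \<le>o ?n"
    using is_piNt_piNt[where 'a='a] assms(2) unfolding is_piNt_def
    using card_of_Card_order by blast
  then show False
    using iso less by (meson not_ordLess_ordLeq ordLeq_ordIso_trans)
qed

end

theory Submission
  imports Defs
begin

text \<open>
  Upper bound: run through all bounded open intervals, each with a marked interior point, along a
  well-order, and keep an interval iff it contains no end point and no marked point of an interval
  kept before. By density the kept intervals form a \<open>\<pi>\<close>-base. A kept interval meeting an earlier
  one lies on one side of the earlier marked point, so the intervals above a given one leave
  pairwise disjoint other sides, and there are at most \<open>\<kappa>\<close> of them.

  Lower bound: given a \<open>\<pi>\<close>-base, shrink its members to marked intervals and choose, by recursion on
  \<open>i < \<kappa>\<close>, maximal families with disjoint shrinkings that avoid all end points and marked points of
  earlier stages. All these points together are not dense, so some open interval misses them; at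
  every stage it lies inside a member of the family, and these members are distinct. Hence some
  member of the \<open>\<pi>\<close>-base has at least \<open>\<kappa>\<close> supersets.
\<close>

section \<open>Open sets in a linear order without isolated points\<close>

lemma infinite_three_ordered:
  fixes A :: "'a::linorder set"
  assumes "infinite A"
  obtains x z y where "x \<in> A" "z \<in> A" "y \<in> A" "x < z" "z < y"
proof -
  obtain B where B: "B \<subseteq> A" "card B = 3"
    using infinite_arbitrarily_large[OF assms] by blast
  then obtain u v w where "B = {u, v, w}" "u \<noteq> v" "v \<noteq> w" "u \<noteq> w"
    by (auto simp: card_3_iff)
  then show ?thesis
    using B(1) that by (metis insert_subset neqE)
qed

text \<open>Finite sets are closed in a T1 space, so deleting all but one point of a finite open set
  would leave an open singleton.\<close>

lemma infinite_open:
  fixes U :: "'a::t1_space set"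
  assumes iso: "\<And>x :: 'a. \<not> open {x}" and "open U" "U \<noteq> {}"
  shows "infinite U"
proof
  assume "finite U"
  obtain x where "x \<in> U" using assms by blast
  have "open (U - (U - {x}))"
    using \<open>open U\<close> \<open>finite U\<close> by (intro open_Diff finite_imp_closed) auto
  moreover have "U - (U - {x}) = {x}" using \<open>x \<in> U\<close> by blast
  ultimately show False using iso by simp
qed

lemma open_contains_interval:
  fixes U :: "'a::linorder_topology set"
  assumes iso: "\<And>x :: 'a. \<not> open {x}" and U: "open U" "U \<noteq> {}"
  obtains a b where "{a<..<b} \<noteq> {}" "{a<..<b} \<subseteq> U"
proof -
  \<comment> \<open>The middle point \<open>z\<close> has points of \<open>U\<close> on both sides,
    so \<open>open_right\<close> and \<open>open_left\<close> both apply to it.\<close>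
  obtain x z y where x: "x \<in> U" "z \<in> U" "y \<in> U" "x < z" "z < y"
    using infinite_open[OF assms] infinite_three_ordered by metis
  obtain b where b: "z < b" "{z..<b} \<subseteq> U"
    using open_right[OF U(1) x(2) x(5)] by blast
  obtain a where a: "a < z" "{a<..z} \<subseteq> U"
    using open_left[OF U(1) x(2) x(4)] by blast
  have "{a<..<b} \<subseteq> U"
  proof
    fix u assume "u \<in> {a<..<b}"
    then show "u \<in> U" using a(2) b(2) by (cases "u \<le> z") auto
  qed
  moreover have "z \<in> {a<..<b}" using a b by simp
  ultimately show ?thesis using that by blast
qed

section \<open>Open intervals with a marked interior point\<close>

type_synonym 'a marked_interval = "'a \<times> 'a \<times> 'a"

text \<open>Because of jumps, \<open>a < m\<close> and \<open>m < b\<close> would not make the two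
  halves non-empty. Both halves must be non-empty since they later serve as disjoint open intervals
  in the cellularity count.\<close>

definition marked :: "'a::linorder marked_interval set" where
  "marked = {(a, m, b). {a<..<m} \<noteq> {} \<and> {m<..<b} \<noteq> {}}"

definition ivl :: "'a::linorder marked_interval \<Rightarrow> 'a set" where
  "ivl t = {fst t<..<snd (snd t)}"

definition pts :: "'a marked_interval \<Rightarrow> 'a set" where
  "pts t = {fst t, fst (snd t), snd (snd t)}"

definition lower :: "'a::linorder marked_interval \<Rightarrow> 'a set" where
  "lower t = {fst t<..<fst (snd t)}"

definition upper :: "'a::linorder marked_interval \<Rightarrow> 'a set" where
  "upper t = {fst (snd t)<..<snd (snd t)}"

lemma finite_pts [simp]: "finite (pts t)"
  by (simp add: pts_def)

lemma markedD:
  assumes "t \<in> marked"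
  shows "fst t < fst (snd t)" "fst (snd t) < snd (snd t)" "fst (snd t) \<in> ivl t"
    "lower t \<noteq> {}" "upper t \<noteq> {}" "lower t \<subseteq> ivl t" "upper t \<subseteq> ivl t" "lower t \<inter> upper t = {}"
  using assms by (force simp: marked_def ivl_def lower_def upper_def)+

text \<open>By convexity, an interval that meets \<open>ivl s\<close> and misses its ends and its
  mark cannot pass any of these three points.\<close>

lemma ivl_subset_half:
  assumes "ivl t \<inter> pts s = {}" "ivl t \<inter> ivl s \<noteq> {}"
  shows "ivl t \<subseteq> lower s \<or> ivl t \<subseteq> upper s"
proof -
  obtain x where x: "x \<in> ivl t" "x \<in> ivl s" using assms(2) by blast
  show ?thesis
  proof (cases "x < fst (snd s)")
    case True
    then have "ivl t \<subseteq> lower s"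
      using x assms(1) unfolding ivl_def pts_def lower_def
      by (auto simp: not_less)
    then show ?thesis ..
  next
    case False
    then have "ivl t \<subseteq> upper s"
      using x assms(1) unfolding ivl_def pts_def upper_def
      by (auto simp: not_less)
    then show ?thesis ..
  qed
qed

lemma open_contains_marked:
  fixes U :: "'a::linorder_topology set"
  assumes iso: "\<And>x :: 'a. \<not> open {x}" and U: "open U" "U \<noteq> {}"
  obtains t where "t \<in> marked" "ivl t \<subseteq> U"
proof -
  obtain a b where ab: "{a<..<b} \<noteq> {}" "{a<..<b} \<subseteq> U"
    using open_contains_interval[OF assms] by blast
  have "infinite {a<..<b}" using infinite_open[OF iso _ ab(1)] by simp
  then obtain x z y where "x \<in> {a<..<b}" "z \<in> {a<..<b}" "y \<in> {a<..<b}" "x < z" "z < y"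
    using infinite_three_ordered by metis
  then have "(a, z, b) \<in> marked" by (force simp: marked_def)
  then show ?thesis using that[of "(a, z, b)"] ab by (simp add: ivl_def)
qed

text \<open>
  As jumps are allowed, the open interval between two distinct points may be empty; \<open>apart p\<close>
  excludes the immediate neighbours of \<open>p\<close>.
\<close>

definition apart :: "'a::linorder \<Rightarrow> 'a set" where
  "apart p = {q. \<exists>z. p < z \<and> z < q \<or> q < z \<and> z < p}"

lemma open_apart: "open (apart (p :: 'a::linorder_topology))"
proof -
  have "apart p = (\<Union>z\<in>{p<..}. {z<..}) \<union> (\<Union>z\<in>{..<p}. {..<z})"
    by (auto simp: apart_def)
  then show ?thesis by (auto intro!: open_Un open_UN)
qed

text \<open>Of three ordered points in \<open>U - {p}\<close>, the middle one separates
  \<open>p\<close> from one of the outer two.\<close>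

lemma open_meets_apart:
  fixes U :: "'a::linorder_topology set"
  assumes "\<And>x :: 'a. \<not> open {x}" "open U" "U \<noteq> {}"
  shows "U \<inter> apart p \<noteq> {}"
proof -
  have "infinite (U - {p})" using infinite_open[OF assms] by simp
  then obtain x z y where "x \<in> U - {p}" "z \<in> U - {p}" "y \<in> U - {p}" "x < z" "z < y"
    using infinite_three_ordered by metis
  then have "x \<in> U \<inter> apart p \<or> y \<in> U \<inter> apart p"
    by (cases "p < z") (auto simp: apart_def not_less le_less)
  then show ?thesis by blast
qed

section \<open>Greedy selection along a well-order\<close>

text \<open>The condition on \<open>G\<close> mentions \<open>G\<close> itself, but only at
  \<open>R\<close>-predecessors of \<open>t\<close>, so well-founded recursion defines its
  characteristic predicate.\<close>

lemma ex_greedy_set: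
  assumes "wf R"
  obtains G where "\<And>t. t \<in> G \<longleftrightarrow> t \<in> T \<and> (\<forall>s\<in>G. (s, t) \<in> R \<longrightarrow> C s t)"
proof -
  define g where "g = wfrec R (\<lambda>f t. t \<in> T \<and> (\<forall>s. (s, t) \<in> R \<longrightarrow> f s \<longrightarrow> C s t))"
  have "g t \<longleftrightarrow> t \<in> T \<and> (\<forall>s. (s, t) \<in> R \<longrightarrow> g s \<longrightarrow> C s t)" for t
    unfolding g_def by (subst wfrec[OF assms]) (auto simp: cut_apply)
  then show ?thesis using that[of "Collect g"] by blast
qed

lemma ex_wf_total: "\<exists>R :: 'a rel. wf R \<and> total R"
proof -
  obtain r :: "'a rel" where "well_order_on UNIV r" using well_order_on by blast
  then show ?thesis
    by (intro exI[of _ "r - Id"]) (auto simp: well_order_on_def linear_order_on_def total_on_def)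
qed

lemma wf_total_least:
  assumes "wf R" "total R" "Q \<noteq> {}"
  shows "\<exists>s\<in>Q. \<forall>t\<in>Q. t \<noteq> s \<longrightarrow> (s, t) \<in> R"
proof (rule wfE_min'[OF assms(1,3)])
  fix s assume s: "s \<in> Q" "\<And>t. (t, s) \<in> R \<Longrightarrow> t \<notin> Q"
  have "(s, t) \<in> R" if "t \<in> Q" "t \<noteq> s" for t
    using s(2)[of t] assms(2) that by (auto simp: total_on_def)
  then show ?thesis using s(1) by (intro bexI[of _ s] ballI impI)
qed

definition greedy :: "'a::linorder marked_interval rel \<Rightarrow> 'a marked_interval set \<Rightarrow> bool" where
  "greedy R G \<longleftrightarrow>
     (\<forall>t. t \<in> G \<longleftrightarrow> t \<in> marked \<and> (\<forall>s\<in>G. (s, t) \<in> R \<longrightarrow> ivl t \<inter> pts s = {}))"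

text \<open>If no kept interval fits into \<open>U\<close>, then ends and marks of kept intervals
  are dense in some interval inside \<open>U\<close>. Two such points that appear early enough
  confine a later kept interval to the gap between them, hence to \<open>U\<close>.\<close>

lemma greedy_pi_base:
  fixes R :: "'a::linorder_topology marked_interval rel"
  assumes iso: "\<And>x :: 'a. \<not> open {x}" and R: "wf R" "total R" and G: "greedy R G"
  shows "pi_base (ivl ` G)"
proof -
  have "\<exists>t\<in>G. ivl t \<subseteq> U" if U: "open U" "U \<noteq> {}" for U
  proof (rule ccontr)
    assume none: "\<not> (\<exists>t\<in>G. ivl t \<subseteq> U)"
    obtain a b where ab: "{a<..<b} \<noteq> {}" "{a<..<b} \<subseteq> U"
      using open_contains_interval[OF iso U] by blast
    let ?I = "{a<..<b}"
    have dense: "\<exists>s\<in>G. pts s \<inter> W \<noteq> {}" if W: "open W" "W \<noteq> {}" "W \<subseteq> ?I" for W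
    proof -
      obtain t where t: "t \<in> marked" "ivl t \<subseteq> W"
        using open_contains_marked[OF iso W(1,2)] by blast
      \<comment> \<open>A rejected \<open>t\<close> must contain an end or the mark of some kept
        \<open>s\<close>.\<close>
      then have "t \<notin> G" using none W(3) ab(2) by blast
      then show ?thesis using t G unfolding greedy_def by blast
    qed
    have least: "\<exists>s\<in>G. pts s \<inter> W \<noteq> {} \<and> (\<forall>s'\<in>G. pts s' \<inter> W \<noteq> {} \<longrightarrow> s' \<noteq> s \<longrightarrow> (s, s') \<in> R)"
      if W: "open W" "W \<noteq> {}" "W \<subseteq> ?I" for W
    proof -
      let ?Q = "{s \<in> G. pts s \<inter> W \<noteq> {}}"
      have ne: "?Q \<noteq> {}" using dense[OF W] by blast
      obtain s where s: "s \<in> ?Q" "\<forall>s'\<in>?Q. s' \<noteq> s \<longrightarrow> (s, s') \<in> R"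
        using wf_total_least[OF R ne] by (elim bexE)
      show ?thesis
      proof (intro bexI[of _ s] conjI ballI impI)
        fix s' assume "s' \<in> G" "pts s' \<inter> W \<noteq> {}" "s' \<noteq> s"
        then show "(s, s') \<in> R" using s(2) by blast
      qed (use s(1) in simp_all)
    qed
    obtain \<beta> where \<beta>: "\<beta> \<in> G" "pts \<beta> \<inter> ?I \<noteq> {}"
      "\<forall>s\<in>G. pts s \<inter> ?I \<noteq> {} \<longrightarrow> s \<noteq> \<beta> \<longrightarrow> (\<beta>, s) \<in> R"
      using least[OF open_greaterThanLessThan ab(1) subset_refl] by (elim bexE conjE)
    obtain p where p: "p \<in> pts \<beta>" "p \<in> ?I" using \<beta>(2) by blast
    \<comment> \<open>Choosing \<open>q\<close> in \<open>apart p\<close> keeps the interval between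
      \<open>p\<close> and \<open>q\<close> non-empty in spite of jumps.\<close>
    have Ip: "open (?I \<inter> apart p)" "?I \<inter> apart p \<noteq> {}" "?I \<inter> apart p \<subseteq> ?I"
      using open_meets_apart[OF iso _ ab(1)] open_apart[of p] by (simp_all add: open_Int)
    obtain \<gamma> where \<gamma>: "\<gamma> \<in> G" "pts \<gamma> \<inter> (?I \<inter> apart p) \<noteq> {}"
      "\<forall>s\<in>G. pts s \<inter> (?I \<inter> apart p) \<noteq> {} \<longrightarrow> s \<noteq> \<gamma> \<longrightarrow> (\<gamma>, s) \<in> R"
      using least[OF Ip] by (elim bexE conjE)
    obtain q where q: "q \<in> pts \<gamma>" "q \<in> ?I" "q \<in> apart p" using \<gamma>(2) by blast
    define J where "J = {min p q<..<max p q}"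
    have J: "open J" "J \<noteq> {}" "J \<subseteq> ?I"
      using p q by (auto simp: J_def apart_def min_def max_def)
    have "infinite (J - pts \<beta> - pts \<gamma>)"
      using infinite_open[OF iso J(1,2)] by simp
    then have "J - pts \<beta> - pts \<gamma> \<noteq> {}" by (metis finite.emptyI)
    moreover have "open (J - pts \<beta> - pts \<gamma>)"
      using J(1) by (simp add: open_Diff finite_imp_closed)
    ultimately have J': "open (J - pts \<beta> - pts \<gamma>)" "J - pts \<beta> - pts \<gamma> \<noteq> {}" by blast+
    \<comment> \<open>Removing the points of \<open>\<beta>\<close> and \<open>\<gamma>\<close>
      makes \<open>\<delta>\<close> differ from both; intersecting with \<open>apart p\<close> makes
      the minimality of \<open>\<gamma>\<close> applicable to \<open>\<delta>\<close>.\<close>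
    let ?W = "(J - pts \<beta> - pts \<gamma>) \<inter> apart p"
    have "open ?W" "?W \<noteq> {}" "?W \<subseteq> ?I"
      using J' J open_apart[of p] open_meets_apart[OF iso J'] by auto
    then obtain \<delta> e where \<delta>: "\<delta> \<in> G" "e \<in> pts \<delta>" "e \<in> ?W" using dense[of ?W] by blast
    have "(\<beta>, \<delta>) \<in> R" "(\<gamma>, \<delta>) \<in> R"
      using \<beta>(3) \<gamma>(3) \<delta> J(3) by blast+
    then have "p \<notin> ivl \<delta>" "q \<notin> ivl \<delta>"
      using G \<beta>(1) \<gamma>(1) \<delta>(1) p q unfolding greedy_def by blast+
    moreover have "\<delta> \<in> marked" using G \<delta>(1) unfolding greedy_def by blast
    \<comment> \<open>The point \<open>e\<close> of \<open>\<delta>\<close> lies strictly between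
      \<open>p\<close> and \<open>q\<close>, and \<open>ivl \<delta>\<close> contains neither, so it
      cannot leave \<open>J\<close>.\<close>
    ultimately have "ivl \<delta> \<subseteq> J"
      using \<delta>(2,3) markedD(1,2)[of \<delta>] unfolding J_def ivl_def pts_def
      by (auto simp: min_def max_def not_less split: if_splits)
    then show False using none \<delta>(1) J(3) ab(2) by blast
  qed
  moreover have "open (ivl t) \<and> ivl t \<noteq> {}" if "t \<in> G" for t
  proof -
    have "t \<in> marked" using that G unfolding greedy_def by blast
    then have "ivl t \<noteq> {}" using markedD(3) by blast
    then show ?thesis by (simp add: ivl_def)
  qed
  ultimately show ?thesis unfolding pi_base_def by (metis imageE imageI)
qed

text \<open>\<open>U s\<close> is a half of \<open>s\<close> away from \<open>ivl t\<close>. If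
  \<open>s\<close> precedes \<open>s'\<close>, then \<open>ivl s'\<close> lies in the half of
  \<open>s\<close> that contains \<open>ivl t\<close>, so it misses \<open>U s\<close>, while
  \<open>U s'\<close> stays inside \<open>ivl s'\<close>.\<close>

lemma greedy_supersets_cellular:
  assumes "total R" and G: "greedy R G" and t: "t \<in> G"
  obtains U :: "'a::linorder marked_interval \<Rightarrow> 'a set"
  where "\<And>s. s \<in> G \<Longrightarrow> ivl t \<subseteq> ivl s \<Longrightarrow> U s \<noteq> {} \<and> (\<exists>a b. U s = {a<..<b})"
    "\<And>s s'. s \<in> G \<Longrightarrow> ivl t \<subseteq> ivl s \<Longrightarrow> s' \<in> G \<Longrightarrow> ivl t \<subseteq> ivl s' \<Longrightarrow> s \<noteq> s' \<Longrightarrow> U s \<inter> U s' = {}"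
proof -
  \<comment> \<open>\<open>lower s\<close> is also the default when neither half contains
    \<open>ivl t\<close>, as for \<open>s = t\<close>.\<close>
  define U where "U s = (if ivl t \<subseteq> lower s then upper s else lower s)" for s
  have mk: "s \<in> marked" if "s \<in> G" for s using G that unfolding greedy_def by blast
  have ne: "ivl t \<noteq> {}" using markedD(3)[OF mk[OF t]] by blast
  have *: "U s \<inter> ivl s' = {}"
    if s: "s \<in> G" "ivl t \<subseteq> ivl s" "s' \<in> G" "ivl t \<subseteq> ivl s'" "(s, s') \<in> R" for s s'
  proof -
    have "ivl s' \<inter> pts s = {}" using G s unfolding greedy_def by blast
    then have "ivl s' \<subseteq> lower s \<or> ivl s' \<subseteq> upper s"
      using ivl_subset_half s ne by blast
    then show ?thesis using markedD(8)[OF mk[OF s(1)]] s(4) ne by (auto simp: U_def)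
  qed
  have sub: "U s \<subseteq> ivl s" if "s \<in> G" for s
    using markedD(6,7)[OF mk[OF that]] by (auto simp: U_def)
  show ?thesis
  proof (rule that[of U])
    fix s assume "s \<in> G"
    show "U s \<noteq> {} \<and> (\<exists>a b. U s = {a<..<b})"
      using markedD(4,5)[OF mk[OF \<open>s \<in> G\<close>]] unfolding U_def lower_def upper_def by auto
  next
    fix s s' assume s: "s \<in> G" "ivl t \<subseteq> ivl s" "s' \<in> G" "ivl t \<subseteq> ivl s'" "s \<noteq> s'"
    then consider "(s, s') \<in> R" | "(s', s) \<in> R" using \<open>total R\<close> unfolding total_on_def by blast
    then show "U s \<inter> U s' = {}"
      using *[of s s'] *[of s' s] sub s by cases blast+
  qed
qed

section \<open>Cellularity and the upper bound\<close>

text \<open>This isolates the cellularity clause of \<open>Suslin_line\<close> for use in both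
  bounds.\<close>

definition cellularity_le :: "'c rel \<Rightarrow> 'a::linorder itself \<Rightarrow> bool" where
  "cellularity_le \<kappa> (L :: 'a itself) \<longleftrightarrow>
     \<not> (\<exists>\<F> :: 'a set set. (\<forall>I\<in>\<F>. I \<noteq> {} \<and> (\<exists>a b. I = {a<..<b})) \<and>
          pairwise disjnt \<F> \<and> |\<F>| =o cardSuc \<kappa>)"

text \<open>The clause forbids only families of size exactly \<open>cardSuc \<kappa>\<close>, so a
  larger index set is first thinned to that size. Disjointness and non-emptiness make
  \<open>U\<close> injective there, so its image has the forbidden size.\<close>

lemma cellularity_leD:
  fixes U :: "'b \<Rightarrow> 'a::linorder set"
  assumes "Card_order \<kappa>" and c: "cellularity_le \<kappa> TYPE('a)"
    and U: "\<And>s. s \<in> S \<Longrightarrow> U s \<noteq> {} \<and> (\<exists>a b. U s = {a<..<b})"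
    and disj: "\<And>s s'. s \<in> S \<Longrightarrow> s' \<in> S \<Longrightarrow> s \<noteq> s' \<Longrightarrow> U s \<inter> U s' = {}"
  shows "|S| <o cardSuc \<kappa>"
proof (rule ccontr)
  assume "\<not> |S| <o cardSuc \<kappa>"
  then have le: "cardSuc \<kappa> \<le>o |S|"
    using assms(1)
    by (simp add: cardSuc_Card_order card_of_Well_order card_order_on_well_order_on
        not_ordLess_iff_ordLeq)
  have F: "|Field (cardSuc \<kappa>)| =o cardSuc \<kappa>"
    using assms(1) by (simp add: cardSuc_Card_order card_of_Field_ordIso)
  obtain f where f: "inj_on f (Field (cardSuc \<kappa>))" "f ` Field (cardSuc \<kappa>) \<subseteq> S"
    using ordIso_ordLeq_trans[OF F le] by (auto simp: card_of_ordLeq[symmetric])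
  define X where "X = f ` Field (cardSuc \<kappa>)"
  have XS: "X \<subseteq> S" using f(2) by (simp add: X_def)
  have "|Field (cardSuc \<kappa>)| =o |X|"
    unfolding X_def by (rule card_of_ordIsoI[OF inj_on_imp_bij_betw[OF f(1)]])
  then have X: "|X| =o cardSuc \<kappa>" using F by (rule ordIso_transitive[OF ordIso_symmetric])
  have "inj_on U X"
    using U disj XS by (intro inj_onI) (metis Int_absorb subsetD)
  then have "|X| =o |U ` X|" by (rule card_of_ordIsoI[OF inj_on_imp_bij_betw])
  then have "|U ` X| =o cardSuc \<kappa>" using X by (rule ordIso_transitive[OF ordIso_symmetric])
  moreover have "pairwise disjnt (U ` X)"
    unfolding pairwise_image using disj XS by (auto simp: pairwise_def disjnt_def subset_iff)
  moreover have "\<forall>I\<in>U ` X. I \<noteq> {} \<and> (\<exists>a b. I = {a<..<b})"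
    using U XS by auto
  ultimately show False using c unfolding cellularity_le_def by metis
qed

lemma ex_cardSuc_op_like_pi_base:
  fixes \<kappa> :: "'c rel"
  assumes "Card_order \<kappa>" and c: "cellularity_le \<kappa> TYPE('a::linorder_topology)"
    and iso: "\<And>x :: 'a. \<not> open {x}"
  shows "\<exists>\<P> :: 'a set set. pi_base \<P> \<and> op_like (cardSuc \<kappa>) \<P>"
proof -
  obtain R :: "'a marked_interval rel" where R: "wf R" "total R"
    using ex_wf_total by blast
  obtain G where G: "greedy R G"
    using ex_greedy_set[OF R(1), of marked "\<lambda>s t. ivl t \<inter> pts s = {}"]
    unfolding greedy_def by blast
  have "|{Q \<in> ivl ` G. ivl t \<subseteq> Q}| <o cardSuc \<kappa>" if t: "t \<in> G" for t
  proof -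
    \<comment> \<open>Supersets are counted as marked intervals; taking images under
      \<open>ivl\<close> cannot increase the count.\<close>
    let ?S = "{s \<in> G. ivl t \<subseteq> ivl s}"
    have "|?S| <o cardSuc \<kappa>"
    proof (rule greedy_supersets_cellular[OF R(2) G t])
      fix U :: "'a marked_interval \<Rightarrow> 'a set"
      assume U: "\<And>s. s \<in> G \<Longrightarrow> ivl t \<subseteq> ivl s \<Longrightarrow> U s \<noteq> {} \<and> (\<exists>a b. U s = {a<..<b})"
        "\<And>s s'. s \<in> G \<Longrightarrow> ivl t \<subseteq> ivl s \<Longrightarrow> s' \<in> G \<Longrightarrow> ivl t \<subseteq> ivl s' \<Longrightarrow>
           s \<noteq> s' \<Longrightarrow> U s \<inter> U s' = {}"
      show ?thesis
        by (rule cellularity_leD[OF assms(1) c, of ?S U]) (simp_all add: U)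
    qed
    then have "|ivl ` ?S| <o cardSuc \<kappa>" by (rule ordLeq_ordLess_trans[OF card_of_image])
    moreover have "{Q \<in> ivl ` G. ivl t \<subseteq> Q} = ivl ` ?S" by auto
    ultimately show ?thesis by simp
  qed
  then have "op_like (cardSuc \<kappa>) (ivl ` G)"
    unfolding op_like_def by (intro ballI) (erule imageE, simp only:)
  then show ?thesis using greedy_pi_base[OF iso R G] by (intro exI conjI)
qed

section \<open>Maximal disjoint families and the lower bound\<close>

text \<open>Zorn's lemma. Only the sets \<open>v Q\<close> are made disjoint, so the members
  \<open>Q\<close> may overlap. A \<open>Q\<close> already in the family is its own witness for
  maximality, whence \<open>v Q \<noteq> {}\<close>.\<close>

lemma ex_maximal_disjoint_family:
  "\<exists>A \<subseteq> \<P>. (\<forall>Q\<in>A. C Q) \<and> (\<forall>Q\<in>A. \<forall>Q'\<in>A. Q \<noteq> Q' \<longrightarrow> v Q \<inter> v Q' = {}) \<and>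
     (\<forall>Q\<in>\<P>. C Q \<longrightarrow> v Q \<noteq> {} \<longrightarrow> (\<exists>Q'\<in>A. v Q \<inter> v Q' \<noteq> {}))"
proof -
  let ?F = "{A. A \<subseteq> \<P> \<and> (\<forall>Q\<in>A. C Q) \<and> (\<forall>Q\<in>A. \<forall>Q'\<in>A. Q \<noteq> Q' \<longrightarrow> v Q \<inter> v Q' = {})}"
  have "\<exists>U\<in>?F. \<forall>X\<in>\<C>. X \<subseteq> U" if "subset.chain ?F \<C>" for \<C>
  proof (intro bexI[of _ "\<Union>\<C>"] CollectI conjI ballI impI)
    fix Q Q' assume Q: "Q \<in> \<Union>\<C>" "Q' \<in> \<Union>\<C>" "Q \<noteq> Q'"
    then obtain X Y where XY: "Q \<in> X" "X \<in> \<C>" "Q' \<in> Y" "Y \<in> \<C>" by blast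
    then have "X \<subseteq> Y \<or> Y \<subseteq> X" using that by (auto simp: subset_chain_def)
    moreover have "X \<in> ?F" "Y \<in> ?F" using that XY unfolding subset_chain_def by blast+
    ultimately show "v Q \<inter> v Q' = {}" using XY Q(3) by blast
  qed (use that in \<open>auto simp: subset_chain_def\<close>)
  then have "\<exists>A\<in>?F. \<forall>X\<in>?F. A \<subseteq> X \<longrightarrow> X = A" by (rule subset_Zorn)
  then obtain A where A: "A \<in> ?F" "\<And>X. X \<in> ?F \<Longrightarrow> A \<subseteq> X \<Longrightarrow> X = A"
    by (elim bexE) simp
  have "\<exists>Q'\<in>A. v Q \<inter> v Q' \<noteq> {}" if Q: "Q \<in> \<P>" "C Q" "v Q \<noteq> {}" for Q
  proof (rule ccontr)
    assume no: "\<not> ?thesis"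
    then have "insert Q A \<in> ?F" using A(1) Q by blast
    then have "Q \<in> A" using A(2) by blast
    then show False using no Q(3) by blast
  qed
  then show ?thesis using A(1) by blast
qed

lemma finite_of_card_of_le:
  assumes "Card_order \<kappa>" "finite (Field \<kappa>)" "|X| \<le>o \<kappa>"
  shows "finite X"
proof -
  have "|X| \<le>o |Field \<kappa>|"
    using assms by (meson card_of_Field_ordIso ordIso_symmetric ordLeq_ordIso_trans)
  then show ?thesis by (rule card_of_ordLeq_finite[OF _ assms(2)])
qed

lemma finite_card_of_le:
  assumes "Card_order \<kappa>" "infinite (Field \<kappa>)" "finite X"
  shows "|X| \<le>o \<kappa>"
proof -
  have "|X| <o \<kappa>"
    using finite_ordLess_infinite[OF card_of_Well_order, of \<kappa> X] assms
    by (simp add: card_order_on_well_order_on Field_card_of)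
  then show ?thesis by (rule ordLess_imp_ordLeq)
qed

text \<open>
  The alternative \<open>finite\<close> makes finite \<open>\<kappa>\<close> harmless: a finite set is never dense in a space without
  isolated points.
\<close>

lemma small_or_finite_UN:
  assumes "Card_order \<kappa>" "|I| \<le>o \<kappa>" "\<And>i. i \<in> I \<Longrightarrow> |A i| \<le>o \<kappa> \<or> finite (A i)"
  shows "|\<Union>i\<in>I. A i| \<le>o \<kappa> \<or> finite (\<Union>i\<in>I. A i)"
proof (cases "finite (Field \<kappa>)")
  case True
  have "finite (A i)" if "i \<in> I" for i
    using assms(3)[OF that] finite_of_card_of_le[OF assms(1) True] by blast
  then show ?thesis using finite_of_card_of_le[OF assms(1) True assms(2)] by blast
next
  case False
  have "\<forall>i\<in>I. |A i| \<le>o \<kappa>"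
    using assms(3) finite_card_of_le[OF assms(1) False] by blast
  then show ?thesis
    using card_of_UNION_ordLeq_infinite_Field[OF False assms(1,2)] by blast
qed

lemma pi_base_member_many_supersets:
  fixes \<kappa> :: "'c rel" and \<P> :: "'a::linorder_topology set set"
  assumes \<kappa>: "Card_order \<kappa>" and c: "cellularity_le \<kappa> TYPE('a)"
    and iso: "\<And>x :: 'a. \<not> open {x}"
    and dens: "\<not> (\<exists>D :: 'a set. |D| \<le>o \<kappa> \<and> closure D = UNIV)"
    and \<P>: "pi_base \<P>"
  shows "\<exists>P\<in>\<P>. \<kappa> \<le>o |{Q \<in> \<P>. P \<subseteq> Q}|"
proof -
  have "\<exists>t. t \<in> marked \<and> ivl t \<subseteq> Q" if "Q \<in> \<P>" for Q
    using open_contains_marked[OF iso, of Q] \<P> that unfolding pi_base_def by metis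
  then obtain \<tau> where \<tau>: "\<And>Q. Q \<in> \<P> \<Longrightarrow> \<tau> Q \<in> marked \<and> ivl (\<tau> Q) \<subseteq> Q"
    by metis
  \<comment> \<open>\<open>A\<close> is chosen for all sets \<open>D\<close> of forbidden points at
    once, so that the recursion below can call it.\<close>
  obtain A where A: "\<And>D. A D \<subseteq> \<P>" "\<And>D Q. Q \<in> A D \<Longrightarrow> ivl (\<tau> Q) \<inter> D = {}"
    "\<And>D Q Q'. Q \<in> A D \<Longrightarrow> Q' \<in> A D \<Longrightarrow> Q \<noteq> Q' \<Longrightarrow> ivl (\<tau> Q) \<inter> ivl (\<tau> Q') = {}"
    "\<And>D Q. Q \<in> \<P> \<Longrightarrow> ivl (\<tau> Q) \<inter> D = {} \<Longrightarrow> ivl (\<tau> Q) \<noteq> {} \<Longrightarrow>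
       \<exists>Q'\<in>A D. ivl (\<tau> Q) \<inter> ivl (\<tau> Q') \<noteq> {}"
    using ex_maximal_disjoint_family[of \<P> "\<lambda>Q. ivl (\<tau> Q) \<inter> D = {}" "\<lambda>Q. ivl (\<tau> Q)" for D]
    by metis
  have Asmall: "|A D| \<le>o \<kappa>" for D
  proof -
    have "|A D| <o cardSuc \<kappa>"
    proof (rule cellularity_leD[OF \<kappa> c, of _ "\<lambda>Q. ivl (\<tau> Q)"])
      fix Q assume "Q \<in> A D"
      then show "ivl (\<tau> Q) \<noteq> {} \<and> (\<exists>a b. ivl (\<tau> Q) = {a<..<b})"
        using A(1) \<tau> markedD(3) unfolding ivl_def by blast
    qed (use A(3) in blast)
    then show ?thesis using \<kappa> by (simp add: cardSuc_ordLeq_ordLess card_of_Card_order)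
  qed
  have wo: "Well_order \<kappa>" using \<kappa> by (simp add: card_order_on_well_order_on)
  let ?R = "\<kappa> - Id"
  have wf: "wf ?R" using wo by (simp add: well_order_on_def)
  \<comment> \<open>Recursion along the strict part of \<open>\<kappa>\<close>: stage
    \<open>i\<close> forbids all ends and marks from earlier stages, named \<open>E j\<close>
    below.\<close>
  define B where "B = wfrec ?R (\<lambda>f i. A (\<Union>j\<in>{j. (j, i) \<in> ?R}. \<Union>Q\<in>f j. pts (\<tau> Q)))"
  define E where "E i = (\<Union>Q\<in>B i. pts (\<tau> Q))" for i
  have B: "B i = A (\<Union>j\<in>{j. (j, i) \<in> ?R}. E j)" for i
  proof -
    have "(\<Union>j\<in>{j. (j, i) \<in> ?R}. \<Union>Q\<in>cut B ?R i j. pts (\<tau> Q)) = (\<Union>j\<in>{j. (j, i) \<in> ?R}. E j)"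
      unfolding E_def by (intro SUP_cong refl) (simp add: cut_apply)
    then show ?thesis unfolding B_def by (subst wfrec[OF wf]) simp
  qed
  have "|E i| \<le>o \<kappa> \<or> finite (E i)" for i
    unfolding E_def by (rule small_or_finite_UN[OF \<kappa>]) (simp_all add: B Asmall)
  moreover have "|Field \<kappa>| \<le>o \<kappa>" using \<kappa> by (simp add: card_of_Field_ordIso ordIso_imp_ordLeq)
  ultimately have "|\<Union>i\<in>Field \<kappa>. E i| \<le>o \<kappa> \<or> finite (\<Union>i\<in>Field \<kappa>. E i)"
    by (intro small_or_finite_UN[OF \<kappa>])
  moreover have "closure D \<noteq> UNIV" if "finite D" for D :: "'a set"
    using that infinite_open[OF iso, of UNIV] by (auto simp: closure_closed finite_imp_closed)
  ultimately have "closure (\<Union>i\<in>Field \<kappa>. E i) \<noteq> UNIV" using dens by blast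
  then have "- closure (\<Union>i\<in>Field \<kappa>. E i) \<noteq> {}" by blast
  then obtain a b where ab: "{a<..<b} \<noteq> {}" "{a<..<b} \<subseteq> - closure (\<Union>i\<in>Field \<kappa>. E i)"
    using open_contains_interval[OF iso] by (metis closed_closure open_Compl)
  let ?G = "{a<..<b}"
  have GE: "?G \<inter> E i = {}" if "i \<in> Field \<kappa>" for i
    using ab(2) closure_subset[of "\<Union>i\<in>Field \<kappa>. E i"] that by blast
  have "open ?G" by simp
  with \<P> ab(1) obtain P where P: "P \<in> \<P>" "P \<subseteq> ?G" unfolding pi_base_def by metis
  have "\<exists>Q. Q \<in> B i \<and> P \<subseteq> Q" if i: "i \<in> Field \<kappa>" for i
  proof -
    have P': "ivl (\<tau> P) \<subseteq> ?G" "ivl (\<tau> P) \<noteq> {}"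
      using \<tau>[OF P(1)] P(2) markedD(3)[of "\<tau> P"] by auto
    have "j \<in> Field \<kappa>" if "(j, i) \<in> ?R" for j using that by (auto simp: Field_def)
    then have "?G \<inter> (\<Union>j\<in>{j. (j, i) \<in> ?R}. E j) = {}" using GE by blast
    then have "ivl (\<tau> P) \<inter> (\<Union>j\<in>{j. (j, i) \<in> ?R}. E j) = {}" using P'(1) by blast
    \<comment> \<open>The shrinking of \<open>P\<close> avoids the forbidden points, so maximality
      of stage \<open>i\<close> provides a member whose shrinking meets it.\<close>
    from A(4)[OF P(1) this P'(2)]
    obtain Q where Q: "Q \<in> B i" "ivl (\<tau> P) \<inter> ivl (\<tau> Q) \<noteq> {}"
      unfolding B[symmetric] by blast
    then obtain x where x: "x \<in> ?G" "x \<in> ivl (\<tau> Q)" using P'(1) by blast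
    have "?G \<inter> pts (\<tau> Q) = {}" using GE[OF i] Q(1) unfolding E_def by blast
    \<comment> \<open>\<open>?G\<close> is convex, meets \<open>ivl (\<tau> Q)\<close> and misses
      both of its ends.\<close>
    then have "?G \<subseteq> ivl (\<tau> Q)"
      using x by (auto simp: ivl_def pts_def not_less)
    then show ?thesis using Q(1) \<tau> A(1) P(2) unfolding B by blast
  qed
  then obtain q where q: "\<And>i. i \<in> Field \<kappa> \<Longrightarrow> q i \<in> B i \<and> P \<subseteq> q i" by metis
  \<comment> \<open>The shrinking of \<open>q j\<close> avoids the mark of \<open>q i\<close>, which
    lies in \<open>E i\<close>; yet every marked interval contains its own mark.\<close>
  have q_neq: "q i \<noteq> q j" if "(i, j) \<in> ?R" for i j
  proof
    assume eq: "q i = q j"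
    have ij: "i \<in> Field \<kappa>" "j \<in> Field \<kappa>" using that by (auto simp: Field_def)
    have "pts (\<tau> (q i)) \<subseteq> E i" using q[OF ij(1)] unfolding E_def by blast
    then have "ivl (\<tau> (q j)) \<inter> pts (\<tau> (q i)) = {}"
      using A(2)[of "q j"] q[OF ij(2)] that unfolding B by blast
    moreover have "q j \<in> \<P>" using q[OF ij(2)] A(1) unfolding B by blast
    ultimately show False
      using markedD(3)[of "\<tau> (q j)"] \<tau>[of "q j"] eq by (auto simp: pts_def)
  qed
  have "inj_on q (Field \<kappa>)"
  proof (rule inj_onI, rule ccontr)
    fix i j assume *: "i \<in> Field \<kappa>" "j \<in> Field \<kappa>" "q i = q j" "i \<noteq> j"
    then have "(i, j) \<in> ?R \<or> (j, i) \<in> ?R"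
      using wo by (auto simp: well_order_on_def linear_order_on_def total_on_def)
    then show False using q_neq *(3) by metis
  qed
  moreover have "q ` Field \<kappa> \<subseteq> {Q \<in> \<P>. P \<subseteq> Q}" using q A(1) unfolding B by blast
  ultimately have "|Field \<kappa>| \<le>o |{Q \<in> \<P>. P \<subseteq> Q}|" by (metis card_of_ordLeq)
  then have "\<kappa> \<le>o |{Q \<in> \<P>. P \<subseteq> Q}|"
    using \<kappa> by (meson card_of_Field_ordIso ordIso_ordLeq_trans ordIso_symmetric)
  then show ?thesis using P(1) by blast
qed

section \<open>The value of the Noetherian pi-type\<close>

theorem corollary2p6:
  fixes \<kappa> :: "'c rel"
  assumes "Card_order \<kappa>"
    and "less_aleph_omega \<kappa>"
    and "Suslin_line \<kappa> TYPE('a::linorder_topology)"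
  shows "piNt TYPE('a) =o cardSuc \<kappa>"
proof -
  let ?p = "piNt TYPE('a)"
  note L = assms(3)[unfolded Suslin_line_def]
  have iso: "\<And>x :: 'a. \<not> open {x}" and c: "cellularity_le \<kappa> TYPE('a)"
    and dens: "\<not> (\<exists>D :: 'a set. |D| \<le>o \<kappa> \<and> closure D = UNIV)"
    using L by (simp_all add: cellularity_le_def)
  obtain \<P> :: "'a set set" where "pi_base \<P>" "op_like (cardSuc \<kappa>) \<P>"
    using ex_cardSuc_op_like_pi_base[OF assms(1) c iso] by blast
  \<comment> \<open>\<open>piNt_le\<close> bridges the types: \<open>cardSuc \<kappa>\<close> and
    \<open>?p\<close> are relations on different types.\<close>
  then have le: "?p \<le>o cardSuc \<kappa>"
    by (rule piNt_le[OF cardSuc_Card_order[OF assms(1)]])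
  have p: "Card_order ?p"
    using is_piNt_piNt[where 'a='a] by (simp add: is_piNt_def)
  \<comment> \<open>The minimum is attained, so the lower bound can be tested on a pi-base realising
    \<open>?p\<close>.\<close>
  obtain \<Q> :: "'a set set" where Q: "pi_base \<Q>" "op_like ?p \<Q>"
    using is_piNt_piNt[where 'a='a] unfolding is_piNt_def by blast
  obtain P where "P \<in> \<Q>" "\<kappa> \<le>o |{Q \<in> \<Q>. P \<subseteq> Q}|"
    using pi_base_member_many_supersets[OF assms(1) c iso dens Q(1)] by blast
  then have "\<kappa> <o ?p" using Q(2) unfolding op_like_def by (meson ordLeq_ordLess_trans)
  then have "cardSuc \<kappa> \<le>o ?p" using assms(1) p by (simp add: cardSuc_least)
  then show ?thesis using le by (simp add: ordIso_iff_ordLeq)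
qed

end
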